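(* Let $X$ be a Banach space and let $T\colon X\to X$ be a bounded invertible linear operator which is dissipative. Then $T$ is conjugate to a shift operator $\sigma_{\mathcal S}\colon \mathbf B\to\mathbf B$, where $\mathbf B\subset Y^{\mathbb Z}$ is a Banach space (for some Banach space $Y$), $\mathcal S=(S_n)_{n\in\mathbb Z}$, and $S_n$ is the identity map on $Y$ for every $n\in\mathbb Z$.
   Context: Dissipative decomposition: a collection $(E_n)_{n\in\mathbb Z}$ of closed subspaces of a Banach space $X$ is a dissipative decomposition of $X$ if for every $x\in X$ there are $x_n\in E_n$ ($n\in\mathbb Z$) such that (a) the sums $x^+=\sum_{n=0}^{+\infty}x_n$ and $x^-=\sum_{n=-\infty}^{-1}x_n$ converge; (b) $x=x^-+x^+$ and this representation (i.e. the sequence $(x_n)_{n\in\mathbb Z}$) is unique; (c) for every $n\in\mathbb Z$ the projection $p_n\colon X\to E_n$, $p_n(x)=x_n$, is continuous. Dissipative operator: $T\colon X\to X$ is dissipative if there is a closed subspace $E_0\subset X$ such that $(T^n(E_0))_{n\in\mathbb Z}$ is a dissipative decomposition of $X$. Shift operator: given a Banach space $Y$, a sequence $\mathcal S=(S_n)_{n\in\mathbb Z}$ of bounded invertible linear operators on $Y$ with $\sup_n\max\{\|S_n\|,\|S_n^{-1}\|\}<\infty$, and a Banach space $\mathbf B$ which is a linear subspace of $Y^{\mathbb Z}$ (with its own complete norm), the shift operator $\sigma_{\mathcal S}\colon\mathbf B\to\mathbf B$ is the bounded invertible linear operator $\sigma_{\mathcal S}((x_n)_{n\in\mathbb Z})=(S_{n+1}(x_{n+1}))_{n\in\mathbb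 Z}$. Conjugate: bounded linear operators $T\colon X\to X$ and $R\colon Z\to Z$ on Banach spaces are conjugate if there is a bounded invertible linear operator (with bounded inverse) $H\colon X\to Z$ with $H\circ T=R\circ H$. *)

theory Defs
  imports "HOL-Analysis.Analysis" "HOL-Library.Function_Algebras"
begin

text \<open>
  Normed spaces are given by explicit data, because the sequence space of a shift operator carries
  a norm of its own that is not attached to its type. The points form a linear subspace of the
  ambient type, whose addition is used; the scalar field is an arbitrary \<^class>\<open>real_normed_field\<close>,
  that is (up to isomorphism) the real or the complex numbers. The values of the norm away from
  the points are irrelevant.
\<close>

record ('k, 'v) normed_space =
  points :: "'v set"
  scalar :: "'k \<Rightarrow> 'v \<Rightarrow> 'v"
  nrm :: "'v \<Rightarrow> real"

definition normed_vector_space ::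
    "('k::real_normed_field, 'v::ab_group_add) normed_space \<Rightarrow> bool" where
  "normed_vector_space V \<longleftrightarrow>
     vector_space (scalar V) \<and> module.subspace (scalar V) (points V) \<and>
     (\<forall>x\<in>points V. 0 \<le> nrm V x \<and> (nrm V x = 0 \<longleftrightarrow> x = 0)) \<and>
     (\<forall>x\<in>points V. \<forall>c. nrm V (scalar V c x) = norm c * nrm V x) \<and>
     (\<forall>x\<in>points V. \<forall>y\<in>points V. nrm V (x + y) \<le> nrm V x + nrm V y)"

definition banach_space ::
    "('k::real_normed_field, 'v::ab_group_add) normed_space \<Rightarrow> bool" where
  "banach_space V \<longleftrightarrow> normed_vector_space V \<and>
     (\<forall>u::nat \<Rightarrow> 'v.
        (\<forall>i. u i \<in> points V) \<and>
        (\<forall>e>0. \<exists>N. \<forall>i\<ge>N. \<forall>j\<ge>N. nrm V (u i - u j) < e) \<longrightarrow>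
        (\<exists>l\<in>points V. (\<lambda>i. nrm V (u i - l)) \<longlonglongrightarrow> 0))"

definition bounded_operator ::
    "('k, 'v::ab_group_add) normed_space \<Rightarrow> ('k, 'w::ab_group_add) normed_space \<Rightarrow> ('v \<Rightarrow> 'w) \<Rightarrow> bool" where
  "bounded_operator V W f \<longleftrightarrow>
     (\<forall>x\<in>points V. f x \<in> points W) \<and>
     (\<forall>x\<in>points V. \<forall>y\<in>points V. f (x + y) = f x + f y) \<and>
     (\<forall>c. \<forall>x\<in>points V. f (scalar V c x) = scalar W c (f x)) \<and>
     (\<exists>C. \<forall>x\<in>points V. nrm W (f x) \<le> C * nrm V x)"

definition bounded_invertible ::
    "('k, 'v::ab_group_add) normed_space \<Rightarrow> ('k, 'w::ab_group_add) normed_space \<Rightarrow> ('v \<Rightarrow> 'w) \<Rightarrow> bool" where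
  "bounded_invertible V W f \<longleftrightarrow>
     bounded_operator V W f \<and> bij_betw f (points V) (points W) \<and>
     bounded_operator W V (inv_into (points V) f)"

text \<open>As for \<^const>\<open>onorm\<close>, the point 0 contributes the quotient 0/0 = 0.\<close>

definition operator_norm ::
    "('k, 'v) normed_space \<Rightarrow> ('k, 'w) normed_space \<Rightarrow> ('v \<Rightarrow> 'w) \<Rightarrow> real" where
  "operator_norm V W f = (SUP x\<in>points V. nrm W (f x) / nrm V x)"

definition conjugate ::
    "('k, 'v::ab_group_add) normed_space \<Rightarrow> ('v \<Rightarrow> 'v) \<Rightarrow>
     ('k, 'w::ab_group_add) normed_space \<Rightarrow> ('w \<Rightarrow> 'w) \<Rightarrow> bool" where
  "conjugate V T W R \<longleftrightarrow>
     (\<exists>H. bounded_invertible V W H \<and> (\<forall>x\<in>points V. H (T x) = R (H x)))"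

text \<open>
  A Banach space occupying a whole type: addition, norm and topology are those of the type, and
  only the scalar multiplication (real or complex) is extra data.
\<close>

definition whole_space :: "('k \<Rightarrow> 'a \<Rightarrow> 'a) \<Rightarrow> ('k, 'a::real_normed_vector) normed_space" where
  "whole_space s = \<lparr>points = UNIV, scalar = s, nrm = norm\<rparr>"

definition two_sided_representation ::
    "(int \<Rightarrow> 'a::real_normed_vector set) \<Rightarrow> 'a \<Rightarrow> (int \<Rightarrow> 'a) \<Rightarrow> bool" where
  "two_sided_representation E x xs \<longleftrightarrow>
     (\<forall>n. xs n \<in> E n) \<and>
     summable (\<lambda>k. xs (int k)) \<and> summable (\<lambda>k. xs (- 1 - int k)) \<and>
     x = (\<Sum>k. xs (- 1 - int k)) + (\<Sum>k. xs (int k))"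

definition dissipative_decomposition ::
    "('k::real_normed_field \<Rightarrow> 'a \<Rightarrow> 'a) \<Rightarrow> (int \<Rightarrow> 'a::real_normed_vector set) \<Rightarrow> bool" where
  "dissipative_decomposition s E \<longleftrightarrow>
     (\<forall>n. module.subspace s (E n) \<and> closed (E n)) \<and>
     (\<forall>x. \<exists>!xs. two_sided_representation E x xs) \<and>
     (\<forall>n. continuous_on UNIV (\<lambda>x. (THE xs. two_sided_representation E x xs) n))"

definition int_iterate :: "('a \<Rightarrow> 'a) \<Rightarrow> int \<Rightarrow> 'a \<Rightarrow> 'a" where
  "int_iterate T n = (if 0 \<le> n then T ^^ nat n else inv T ^^ nat (- n))"

definition dissipative ::
    "('k::real_normed_field \<Rightarrow> 'a \<Rightarrow> 'a) \<Rightarrow> ('a::real_normed_vector \<Rightarrow> 'a) \<Rightarrow> bool" where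
  "dissipative s T \<longleftrightarrow>
     (\<exists>E0. module.subspace s E0 \<and> closed E0 \<and>
        dissipative_decomposition s (\<lambda>n. int_iterate T n ` E0))"

definition shift :: "(int \<Rightarrow> 'y \<Rightarrow> 'y) \<Rightarrow> (int \<Rightarrow> 'y) \<Rightarrow> int \<Rightarrow> 'y" where
  "shift S x = (\<lambda>n. S (n + 1) (x (n + 1)))"

definition sequence_banach_space ::
    "('k::real_normed_field, 'y::ab_group_add) normed_space \<Rightarrow> ('k, int \<Rightarrow> 'y) normed_space \<Rightarrow> bool" where
  "sequence_banach_space Y B \<longleftrightarrow>
     banach_space B \<and> (\<forall>x\<in>points B. \<forall>n. x n \<in> points Y) \<and>
     scalar B = (\<lambda>c x n. scalar Y c (x n))"

definition shift_operator ::
    "('k::real_normed_field, 'y::ab_group_add) normed_space \<Rightarrow> (int \<Rightarrow> 'y \<Rightarrow> 'y) \<Rightarrow>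
     ('k, int \<Rightarrow> 'y) normed_space \<Rightarrow> bool" where
  "shift_operator Y S B \<longleftrightarrow>
     banach_space Y \<and> sequence_banach_space Y B \<and>
     (\<forall>n. bounded_invertible Y Y (S n)) \<and>
     bdd_above (range (\<lambda>n. max (operator_norm Y Y (S n))
                               (operator_norm Y Y (inv_into (points Y) (S n))))) \<and>
     bounded_invertible B B (shift S)"

end

theory Submission
  imports Defs
begin

text \<open>
  Let \<open>E\<^sub>0\<close> be a subspace whose images \<open>T\<^sup>n(E\<^sub>0)\<close> form a dissipative decomposition. Since \<open>T\<close> is
  invertible, the component of \<open>x\<close> in \<open>T\<^sup>n(E\<^sub>0)\<close> is \<open>T\<^sup>n y\<close> for exactly one \<open>y \<in> E\<^sub>0\<close>; let
  \<open>H x\<close> be the sequence whose entry at \<open>-n\<close> is this \<open>y\<close>. Applying \<open>T\<close> termwise to the series of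
  \<open>x\<close> moves the component \<open>T\<^sup>n y\<close> to the place \<open>n + 1\<close>, so uniqueness of representations says that
  \<open>H (T x)\<close> is \<open>H x\<close> moved one place to the left: this is the shift whose weights are all the
  identity (\<open>H_intertwines\<close>). The sign in \<open>-n\<close> is there because \<^const>\<open>shift\<close> moves entries to the
  left whereas \<open>T\<close> moves components to the right.

  Uniqueness also makes \<open>H\<close> linear, and \<open>H\<close> is injective because a sequence has at most one sum.
  So one takes for \<open>\<^bold>B\<close> the range of \<open>H\<close> inside the sequences in \<open>Y = E\<^sub>0\<close>, with the norm that
  makes \<open>H\<close> an isometry. Completeness of \<open>\<^bold>B\<close> and boundedness of the shift and of its inverse are
  then inherited from \<open>X\<close> and \<open>T\<close> (\<open>banach_space_push_forward\<close>, \<open>bounded_invertible_intertwined\<close>).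
\<close>

section \<open>Bounded operators and transport of structure\<close>

lemma bounded_operator_compose:
  assumes f: "bounded_operator U V f" and g: "bounded_operator V W g"
    and nonneg: "\<And>y. y \<in> points V \<Longrightarrow> 0 \<le> nrm V y"
  shows "bounded_operator U W (\<lambda>x. g (f x))"
proof -
  obtain C where C: "\<And>x. x \<in> points U \<Longrightarrow> nrm V (f x) \<le> C * nrm U x"
    using f unfolding bounded_operator_def by blast
  obtain D where D: "\<And>y. y \<in> points V \<Longrightarrow> nrm W (g y) \<le> D * nrm V y"
    using g unfolding bounded_operator_def by blast
  have "nrm W (g (f x)) \<le> (\<bar>D\<bar> * C) * nrm U x" if x: "x \<in> points U" for x
  proof -
    have fx: "f x \<in> points V" using f x unfolding bounded_operator_def by blast
    have "nrm W (g (f x)) \<le> D * nrm V (f x)" using D fx .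
    also have "\<dots> \<le> \<bar>D\<bar> * nrm V (f x)" using nonneg[OF fx] by (intro mult_right_mono) auto
    also have "\<dots> \<le> \<bar>D\<bar> * (C * nrm U x)" using C[OF x] by (intro mult_left_mono) auto
    finally show ?thesis by (simp add: mult.assoc)
  qed
  then show ?thesis
    using f g unfolding bounded_operator_def by metis
qed

lemma bounded_operator_cong:
  assumes "module.subspace (scalar V) (points V)" "module (scalar V)"
    and "\<And>x. x \<in> points V \<Longrightarrow> f x = g x"
  shows "bounded_operator V W f \<longleftrightarrow> bounded_operator V W g"
proof -
  have "x + y \<in> points V" if "x \<in> points V" "y \<in> points V" for x y
    using assms(1,2) that by (simp add: module.subspace_def)
  moreover have "scalar V c x \<in> points V" if "x \<in> points V" for c x
    using assms(1,2) that by (simp add: module.subspace_def)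
  ultimately show ?thesis
    unfolding bounded_operator_def using assms(3) by (simp cong: ball_cong)
qed

lemma bounded_invertibleI:
  assumes V: "module.subspace (scalar V) (points V)" "module (scalar V)"
    and W: "module.subspace (scalar W) (points W)" "module (scalar W)"
    and f: "bounded_operator V W f" and g: "bounded_operator W V g"
    and gf: "\<And>x. x \<in> points V \<Longrightarrow> g (f x) = x" and fg: "\<And>y. y \<in> points W \<Longrightarrow> f (g y) = y"
  shows "bounded_invertible V W f"
proof -
  have bij: "bij_betw f (points V) (points W)"
    by (rule bij_betw_byWitness[where f' = g])
      (use f g gf fg in \<open>auto simp: bounded_operator_def\<close>)
  have "inv_into (points V) f y = g y" if y: "y \<in> points W" for y
    using bij y g fg by (intro inv_into_f_eq) (auto simp: bounded_operator_def bij_betw_def)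
  then show ?thesis
    unfolding bounded_invertible_def using f g bij bounded_operator_cong[OF W] by metis
qed

lemma normed_vector_spaceD:
  assumes "normed_vector_space V"
  shows "module (scalar V)" "module.subspace (scalar V) (points V)"
    and "\<And>x. x \<in> points V \<Longrightarrow> 0 \<le> nrm V x"
  using assms by (auto simp: normed_vector_space_def vector_space_def module_def)

lemma bounded_invertible_identity:
  assumes "normed_vector_space V"
  shows "bounded_invertible V V (\<lambda>x. x)"
proof -
  have "bounded_operator V V (\<lambda>x. x)"
    unfolding bounded_operator_def by (auto intro: exI[of _ 1])
  then show ?thesis
    using normed_vector_spaceD[OF assms] by (intro bounded_invertibleI[where g = "\<lambda>x. x"]) auto
qed

text \<open>
  On the target, \<open>R\<close> is \<open>H T H\<^sup>-\<^sup>1\<close>, and \<open>H T\<^sup>-\<^sup>1 H\<^sup>-\<^sup>1\<close> is its inverse.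
\<close>

lemma bounded_invertible_intertwined:
  assumes V: "normed_vector_space V" and W: "normed_vector_space W"
    and H: "bounded_invertible V W H" and T: "bounded_invertible V V T"
    and HT: "\<And>x. x \<in> points V \<Longrightarrow> H (T x) = R (H x)"
  shows "bounded_invertible W W R"
proof -
  note VD = normed_vector_spaceD[OF V] and WD = normed_vector_spaceD[OF W]
  define G where "G = inv_into (points V) H"
  define T' where "T' = inv_into (points V) T"
  have ops: "bounded_operator V W H" "bounded_operator W V G"
    "bounded_operator V V T" "bounded_operator V V T'"
    using H T by (auto simp: bounded_invertible_def G_def T'_def)
  have mem: "\<And>x. x \<in> points V \<Longrightarrow> H x \<in> points W" "\<And>y. y \<in> points W \<Longrightarrow> G y \<in> points V"
    "\<And>x. x \<in> points V \<Longrightarrow> T x \<in> points V" "\<And>x. x \<in> points V \<Longrightarrow> T' x \<in> points V"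
    using ops by (auto simp: bounded_operator_def)
  have inv: "\<And>y. y \<in> points W \<Longrightarrow> H (G y) = y" "\<And>x. x \<in> points V \<Longrightarrow> G (H x) = x"
    "\<And>x. x \<in> points V \<Longrightarrow> T (T' x) = x" "\<And>x. x \<in> points V \<Longrightarrow> T' (T x) = x"
    using H T
    by (auto simp: bounded_invertible_def G_def T'_def bij_betw_inv_into_left
        bij_betw_inv_into_right)
  have R: "R y = H (T (G y))" if "y \<in> points W" for y
    using HT[OF mem(2)[OF that]] inv(1)[OF that] by simp
  have "bounded_operator W W (\<lambda>y. H (T (G y)))"
    by (intro bounded_operator_compose[OF bounded_operator_compose[OF ops(2,3)] ops(1)] VD WD)
  then have "bounded_operator W W R"
    using bounded_operator_cong[OF WD(2,1), of R "\<lambda>y. H (T (G y))"] R by blast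
  moreover have "bounded_operator W W (\<lambda>y. H (T' (G y)))"
    by (intro bounded_operator_compose[OF bounded_operator_compose[OF ops(2,4)] ops(1)] VD WD)
  ultimately show ?thesis
    using WD by (intro bounded_invertibleI[where g = "\<lambda>y. H (T' (G y))"]) (auto simp: R mem inv)
qed

definition push_forward ::
    "('k, 'v) normed_space \<Rightarrow> ('k \<Rightarrow> 'w \<Rightarrow> 'w) \<Rightarrow> ('v \<Rightarrow> 'w) \<Rightarrow> ('k, 'w) normed_space" where
  "push_forward V sc H =
     \<lparr>points = H ` points V, scalar = sc, nrm = (\<lambda>y. nrm V (inv_into (points V) H y))\<rparr>"

text \<open>
  The norm of \<^const>\<open>push_forward\<close> makes the injective linear map \<open>H\<close> an isometry, so that every
  axiom about the image, completeness included, is the same axiom about \<open>V\<close>.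
\<close>

lemma banach_space_push_forward:
  fixes V :: "('k::real_normed_field, 'v::ab_group_add) normed_space"
    and sc :: "'k \<Rightarrow> 'w::ab_group_add \<Rightarrow> 'w"
  assumes V: "banach_space V" and sc: "vector_space sc"
    and add: "\<And>x y. x \<in> points V \<Longrightarrow> y \<in> points V \<Longrightarrow> H (x + y) = H x + H y"
    and scale: "\<And>c x. x \<in> points V \<Longrightarrow> H (scalar V c x) = sc c (H x)"
    and inj: "inj_on H (points V)"
  shows "banach_space (push_forward V sc H)"
    and "bounded_invertible V (push_forward V sc H) H"
proof -
  define W where "W = push_forward V sc H"
  have W: "points W = H ` points V" "scalar W = sc"
    by (simp_all add: W_def push_forward_def)
  have nV: "normed_vector_space V" using V by (simp add: banach_space_def)
  note VD = normed_vector_spaceD[OF nV]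
  have modsc: "module sc" using sc by (auto simp: vector_space_def module_def)
  have nW [simp]: "nrm W (H x) = nrm V x" if "x \<in> points V" for x
    using that inj by (simp add: W_def push_forward_def)
  have sub: "0 \<in> points V" "\<And>x y. x \<in> points V \<Longrightarrow> y \<in> points V \<Longrightarrow> x + y \<in> points V"
    "\<And>c x. x \<in> points V \<Longrightarrow> scalar V c x \<in> points V"
    "\<And>x y. x \<in> points V \<Longrightarrow> y \<in> points V \<Longrightarrow> x - y \<in> points V"
    using VD by (auto simp: module.subspace_def module.subspace_diff)
  have H0: "H 0 = 0" using add[OF sub(1) sub(1)] by simp
  have Hd: "H (x - y) = H x - H y" if "x \<in> points V" "y \<in> points V" for x y
    using add[OF sub(4)[OF that] that(2)] by (simp add: eq_diff_eq)
  have H0': "H x = 0 \<longleftrightarrow> x = 0" if "x \<in> points V" for x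
    using inj_onD[OF inj, of x 0] that sub(1) H0 by auto
  have axioms: "nrm V x = 0 \<longleftrightarrow> x = 0" "nrm V (scalar V c x) = norm c * nrm V x"
      if "x \<in> points V" for c x
    using nV that by (auto simp: normed_vector_space_def)
  have triangle: "nrm V (x + y) \<le> nrm V x + nrm V y" if "x \<in> points V" "y \<in> points V" for x y
    using nV that by (auto simp: normed_vector_space_def)
  have subW: "module.subspace sc (points W)"
    unfolding module.subspace_def[OF modsc] W
  proof (intro conjI ballI allI)
    show "0 \<in> H ` points V" using sub(1) H0 by (metis imageI)
    show "a + b \<in> H ` points V" if "a \<in> H ` points V" "b \<in> H ` points V" for a b
      using that sub(2) by (auto simp flip: add)
    show "sc c a \<in> H ` points V" if "a \<in> H ` points V" for c a
      using that sub(3) by (auto simp flip: scale)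
  qed
  have nW_space: "normed_vector_space W"
    unfolding normed_vector_space_def W(2)
  proof (intro conjI sc subW)
    show "\<forall>x\<in>points W. 0 \<le> nrm W x \<and> (nrm W x = 0 \<longleftrightarrow> x = 0)"
      using VD(3) by (auto simp: W H0' axioms(1))
    show "\<forall>x\<in>points W. \<forall>c. nrm W (sc c x) = norm c * nrm W x"
      using sub(3) by (auto simp: W axioms(2) simp flip: scale)
    show "\<forall>x\<in>points W. \<forall>y\<in>points W. nrm W (x + y) \<le> nrm W x + nrm W y"
      using sub(2) by (auto simp: W triangle simp flip: add)
  qed
  show "banach_space (push_forward V sc H)"
    unfolding W_def[symmetric] banach_space_def
  proof (intro conjI nW_space allI impI)
    fix u :: "nat \<Rightarrow> 'w"
    assume u: "(\<forall>i. u i \<in> points W) \<and> (\<forall>e>0. \<exists>N. \<forall>i\<ge>N. \<forall>j\<ge>N. nrm W (u i - u j) < e)"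
    then have "\<forall>i. \<exists>x. x \<in> points V \<and> u i = H x" by (auto simp: W)
    then obtain v where v: "\<And>i. v i \<in> points V" "\<And>i. u i = H (v i)" by metis
    have "\<forall>e>0. \<exists>N. \<forall>i\<ge>N. \<forall>j\<ge>N. nrm V (v i - v j) < e"
      using u v sub(4) by (simp flip: Hd)
    then obtain l where l: "l \<in> points V" "(\<lambda>i. nrm V (v i - l)) \<longlonglongrightarrow> 0"
      using V v(1) unfolding banach_space_def by blast
    have "(\<lambda>i. nrm W (u i - H l)) \<longlonglongrightarrow> 0"
      using l v sub(4) by (simp flip: Hd)
    then show "\<exists>l\<in>points W. (\<lambda>i. nrm W (u i - l)) \<longlonglongrightarrow> 0"
      using l(1) W(1) by blast
  qed
  define G where "G = inv_into (points V) H"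
  have G: "G (H x) = x" if "x \<in> points V" for x
    using that inj by (simp add: G_def)
  have bH: "bounded_operator V W H"
    unfolding bounded_operator_def W
    by (intro conjI exI[of _ 1]) (auto simp: add scale)
  have bG: "bounded_operator W V G"
    unfolding bounded_operator_def W using sub(2,3)
    by (intro conjI exI[of _ 1]) (auto simp: G simp flip: add scale)
  show "bounded_invertible V (push_forward V sc H) H"
    unfolding W_def[symmetric]
    by (rule bounded_invertibleI[OF VD(2,1) _ _ bH bG]) (use subW modsc W in \<open>auto simp: G\<close>)
qed

lemma banach_space_closed_subspace:
  fixes s :: "'k::real_normed_field \<Rightarrow> 'a::banach \<Rightarrow> 'a"
  assumes s: "normed_vector_space (whole_space s)"
    and E: "module.subspace s E" "closed E"
  shows "banach_space \<lparr>points = E, scalar = s, nrm = norm\<rparr>"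
  unfolding banach_space_def
proof (intro conjI allI impI)
  show "normed_vector_space \<lparr>points = E, scalar = s, nrm = norm\<rparr>"
    using s E(1) by (auto simp: normed_vector_space_def whole_space_def)
  fix u :: "nat \<Rightarrow> 'a"
  assume "(\<forall>i. u i \<in> points \<lparr>points = E, scalar = s, nrm = norm\<rparr>) \<and>
    (\<forall>e>0. \<exists>N. \<forall>i\<ge>N. \<forall>j\<ge>N. nrm \<lparr>points = E, scalar = s, nrm = norm\<rparr> (u i - u j) < e)"
  then have u: "\<And>i. u i \<in> E" and "Cauchy u"
    by (auto simp: Cauchy_def dist_norm)
  then obtain l where l: "u \<longlonglongrightarrow> l" using Cauchy_convergent_iff convergent_def by blast
  have "l \<in> E" using closed_sequentially[OF E(2)] u l by blast
  moreover have "(\<lambda>i. norm (u i - l)) \<longlonglongrightarrow> 0"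
    using l by (simp add: LIM_zero_iff tendsto_norm_zero_iff)
  ultimately show "\<exists>l\<in>points \<lparr>points = E, scalar = s, nrm = norm\<rparr>.
      (\<lambda>i. nrm \<lparr>points = E, scalar = s, nrm = norm\<rparr> (u i - l)) \<longlonglongrightarrow> 0"
    by auto
qed

section \<open>Two-sided series\<close>

definition two_sided_sums :: "(int \<Rightarrow> 'a::real_normed_vector) \<Rightarrow> 'a \<Rightarrow> bool" where
  "two_sided_sums u x \<longleftrightarrow>
     (\<exists>a b. (\<lambda>k. u (- 1 - int k)) sums a \<and> (\<lambda>k. u (int k)) sums b \<and> x = a + b)"

lemma two_sided_representation_iff:
  "two_sided_representation E x u \<longleftrightarrow> (\<forall>n. u n \<in> E n) \<and> two_sided_sums u x"
  unfolding two_sided_representation_def two_sided_sums_def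
  by (auto simp: sums_iff)

lemma two_sided_sums_unique: "two_sided_sums u x \<Longrightarrow> two_sided_sums u y \<Longrightarrow> x = y"
  unfolding two_sided_sums_def by (auto dest: sums_unique2)

lemma two_sided_sums_add:
  assumes "two_sided_sums u x" "two_sided_sums v y"
  shows "two_sided_sums (\<lambda>n. u n + v n) (x + y)"
proof -
  obtain a b where "(\<lambda>k. u (- 1 - int k)) sums a" "(\<lambda>k. u (int k)) sums b" "x = a + b"
    using assms(1) unfolding two_sided_sums_def by blast
  moreover obtain c d where "(\<lambda>k. v (- 1 - int k)) sums c" "(\<lambda>k. v (int k)) sums d" "y = c + d"
    using assms(2) unfolding two_sided_sums_def by blast
  ultimately show ?thesis
    unfolding two_sided_sums_def
    by (intro exI[of _ "a + c"] exI[of _ "b + d"]) (simp add: sums_add algebra_simps)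
qed

text \<open>
  Additivity and a norm bound give continuity at 0, hence everywhere. In this form the fact
  applies to maps that are linear over the scalar field of the space, whichever field that is.
\<close>

lemma sums_additive_bounded:
  fixes f :: "'a::real_normed_vector \<Rightarrow> 'b::real_normed_vector"
  assumes add: "\<And>x y. f (x + y) = f x + f y" and bound: "\<And>x. norm (f x) \<le> C * norm x"
    and u: "u sums l"
  shows "(\<lambda>k. f (u k)) sums f l"
proof -
  interpret additive f by standard (rule add)
  have "(\<lambda>n. norm (sum u {..<n} - l)) \<longlonglongrightarrow> 0"
    using u unfolding sums_def by (simp add: LIM_zero_iff tendsto_norm_zero_iff)
  then have "(\<lambda>n. C * norm (sum u {..<n} - l)) \<longlonglongrightarrow> 0" by (rule tendsto_mult_right_zero)
  then have "(\<lambda>n. f (sum u {..<n} - l)) \<longlonglongrightarrow> 0"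
    by (rule Lim_null_comparison[rotated]) (simp add: bound)
  then show ?thesis
    unfolding sums_def by (simp add: diff sum LIM_zero_iff)
qed

lemma two_sided_sums_additive_bounded:
  fixes f :: "'a::real_normed_vector \<Rightarrow> 'b::real_normed_vector"
  assumes add: "\<And>x y. f (x + y) = f x + f y" and bound: "\<And>x. norm (f x) \<le> C * norm x"
    and u: "two_sided_sums u x"
  shows "two_sided_sums (\<lambda>n. f (u n)) (f x)"
proof -
  obtain a b where "(\<lambda>k. u (- 1 - int k)) sums a" "(\<lambda>k. u (int k)) sums b" "x = a + b"
    using u unfolding two_sided_sums_def by blast
  then show ?thesis
    unfolding two_sided_sums_def using sums_additive_bounded[of f, OF add bound]
    by (intro exI[of _ "f a"] exI[of _ "f b"]) (simp add: add)
qed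

text \<open>
  Moving the origin transfers the single term \<open>u (-1)\<close> from the negative half to the other.
\<close>

lemma two_sided_sums_translate:
  assumes "two_sided_sums u x"
  shows "two_sided_sums (\<lambda>n. u (n - 1)) x"
proof -
  obtain a b where a: "(\<lambda>k. u (- 1 - int k)) sums a" and b: "(\<lambda>k. u (int k)) sums b"
    and x: "x = a + b"
    using assms unfolding two_sided_sums_def by blast
  have "(\<lambda>k. u (- 1 - int (Suc k))) sums (a - u (- 1))"
    using a by (subst sums_Suc_iff) simp
  moreover have "- 1 - int (Suc k) = - 1 - int k - 1" for k by simp
  ultimately have "(\<lambda>k. u (- 1 - int k - 1)) sums (a - u (- 1))" by (simp only:)
  moreover have "(\<lambda>k. u (int k - 1)) sums (b + u (- 1))"
    using sums_Suc[of "\<lambda>k. u (int k - 1)" b] b by simp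
  ultimately show ?thesis
    unfolding two_sided_sums_def x
    by (intro exI[of _ "a - u (- 1)"] exI[of _ "b + u (- 1)"]) simp
qed

section \<open>Integer iterates\<close>

lemma int_iterate_succ:
  assumes "bij T"
  shows "int_iterate T (n + 1) x = T (int_iterate T n x)"
proof (cases "0 \<le> n")
  case True
  then have "nat (n + 1) = Suc (nat n)" by simp
  then show ?thesis using True by (simp add: int_iterate_def)
next
  case False
  then have "nat (- n) = Suc (nat (- (n + 1)))" by simp
  moreover have "T (inv T z) = z" for z using assms by (simp add: bij_is_surj surj_f_inv_f)
  ultimately show ?thesis
    using False by (cases "n = - 1") (simp_all add: int_iterate_def)
qed

lemma inj_int_iterate:
  assumes "bij T"
  shows "inj (int_iterate T n)"
  using bij_fn[OF assms] bij_fn[OF bij_imp_bij_inv[OF assms]]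
  by (simp add: int_iterate_def bij_is_inj)

lemma int_iterate_commute:
  assumes "bij T" "\<And>x. T (f x) = f (T x)"
  shows "int_iterate T n (f x) = f (int_iterate T n x)"
proof -
  have "inv T (f x) = f (inv T x)" for x
    by (metis assms bij_inv_eq_iff)
  moreover have "(g ^^ k) (f x) = f ((g ^^ k) x)" if "\<And>x. g (f x) = f (g x)" for g k
    by (induction k) (simp_all add: that)
  ultimately show ?thesis
    using assms(2) by (simp add: int_iterate_def)
qed

lemma int_iterate_add:
  assumes "bij T" "\<And>x y. T (x + y) = T x + T y"
  shows "int_iterate T n (x + y) = int_iterate T n x + int_iterate T n y"
proof -
  have "inv T (x + y) = inv T x + inv T y" for x y
    by (metis assms bij_inv_eq_iff)
  moreover have "(g ^^ k) (x + y) = (g ^^ k) x + (g ^^ k) y"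
    if "\<And>x y. g (x + y) = g x + g y" for g :: "'a \<Rightarrow> 'a" and k
    by (induction k) (simp_all add: that)
  ultimately show ?thesis
    using assms(2) by (simp add: int_iterate_def)
qed

section \<open>The conjugacy with the shift\<close>

theorem theorem2p2:
  fixes s :: "'k::real_normed_field \<Rightarrow> 'a::banach \<Rightarrow> 'a" and T :: "'a \<Rightarrow> 'a"
  assumes "banach_space (whole_space s)"
    and "bounded_invertible (whole_space s) (whole_space s) T"
    and "dissipative s T"
  shows "\<exists>(Y :: ('k, 'a) normed_space) (B :: ('k, int \<Rightarrow> 'a) normed_space) S.
           shift_operator Y S B \<and>
           (\<forall>n. \<forall>y\<in>points Y. S n y = y) \<and>
           conjugate (whole_space s) T B (shift S)"
proof -
  let ?X = "whole_space s"
  have pX [simp]: "points ?X = UNIV" "scalar ?X = s" "nrm ?X = norm"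
    by (simp_all add: whole_space_def)
  have nX: "normed_vector_space ?X" using assms(1) by (simp add: banach_space_def)
  have vs: "vector_space s" using nX by (simp add: normed_vector_space_def)
  have ms: "module s" using normed_vector_spaceD(1)[OF nX] by simp
  have s_add: "s c (x + y) = s c x + s c y" and s_norm: "norm (s c x) \<le> norm c * norm x" for c x y
    using vs nX by (auto simp: vector_space_def normed_vector_space_def)
  have T_add: "T (x + y) = T x + T y" and T_scale: "T (s c x) = s c (T x)" for c x y
    using assms(2) by (auto simp: bounded_invertible_def bounded_operator_def)
  obtain C where T_norm: "\<And>x. norm (T x) \<le> C * norm x"
    using assms(2) by (auto simp: bounded_invertible_def bounded_operator_def)
  have bij: "bij T" using assms(2) by (simp add: bounded_invertible_def)
  let ?J = "int_iterate T"
  have J_add: "?J n (x + y) = ?J n x + ?J n y" for n x y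
    using int_iterate_add[of T, OF bij T_add] .
  have J_scale: "?J n (s c x) = s c (?J n x)" for n c x
    using int_iterate_commute[of T "s c", OF bij T_scale] .
  obtain E where E: "module.subspace s E" "closed E"
    and D: "dissipative_decomposition s (\<lambda>n. ?J n ` E)"
    using assms(3) unfolding dissipative_def by blast
  have E_add: "\<And>x y. x \<in> E \<Longrightarrow> y \<in> E \<Longrightarrow> x + y \<in> E"
    and E_scale: "\<And>c x. x \<in> E \<Longrightarrow> s c x \<in> E"
    using E(1) by (auto simp: module.subspace_def[OF ms])

  \<comment> \<open>\<open>R\<close> is the graph of \<open>H\<close>. Each identity for \<open>H\<close> below reduces to a closure property of
    \<open>R\<close>, by uniqueness of \<open>y\<close> (\<open>H_eq\<close>).\<close>
  define R where "R x y \<longleftrightarrow> (\<forall>n. y n \<in> E) \<and> two_sided_sums (\<lambda>n. ?J n (y (- n))) x" for x y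
  have R_rep: "two_sided_representation (\<lambda>n. ?J n ` E) x (\<lambda>n. ?J n (y (- n)))" if "R x y" for x y
    using that by (auto simp: R_def two_sided_representation_iff)
  have rep: "\<exists>!u. two_sided_representation (\<lambda>n. ?J n ` E) x u" for x
    using D unfolding dissipative_decomposition_def by blast
  have R_ex: "\<exists>y. R x y" for x
  proof -
    obtain u where u: "\<And>n. u n \<in> ?J n ` E" "two_sided_sums u x"
      using rep[of x] unfolding two_sided_representation_iff by blast
    then have "\<forall>n. \<exists>z. z \<in> E \<and> u n = ?J n z" by blast
    then obtain z where z: "\<And>n. z n \<in> E" "\<And>n. u n = ?J n (z n)" by metis
    have "R x (\<lambda>n. z (- n))"
      using u(2) z(1) unfolding R_def by (simp flip: z(2))
    then show ?thesis by blast
  qed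
  have R_unique: "y = y'" if "R x y" "R x y'" for x y y'
  proof
    fix n
    have "(\<lambda>n. ?J n (y (- n))) = (\<lambda>n. ?J n (y' (- n)))"
      using rep R_rep that by blast
    from fun_cong[OF this, of "- n"] show "y n = y' n"
      using inj_int_iterate[OF bij, of "- n"] by (simp add: inj_eq)
  qed
  define H where "H x = (THE y. R x y)" for x
  have RH: "R x (H x)" for x
    unfolding H_def using R_ex R_unique by (metis theI)
  have H_eq: "H x = y" if "R x y" for x y
    using R_unique RH that by blast

  define sc :: "'k \<Rightarrow> (int \<Rightarrow> 'a) \<Rightarrow> int \<Rightarrow> 'a" where "sc = (\<lambda>c x n. s c (x n))"
  have sc: "vector_space sc"
    using vs by (auto simp: vector_space_def sc_def fun_eq_iff)
  have H_add: "H (x + y) = H x + H y" for x y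
  proof (rule H_eq)
    show "R (x + y) (H x + H y)"
      using RH[of x] RH[of y] unfolding R_def
      by (auto simp: J_add E_add intro: two_sided_sums_add)
  qed
  have H_scale: "H (s c x) = sc c (H x)" for c x
  proof (rule H_eq)
    show "R (s c x) (sc c (H x))"
      using RH[of x] two_sided_sums_additive_bounded[of "s c", OF s_add s_norm] unfolding R_def
      by (auto simp: sc_def J_scale E_scale)
  qed
  have H_inj: "inj H"
  proof (rule injI)
    fix x y assume "H x = H y"
    then show "x = y"
      using RH[of x] RH[of y] unfolding R_def by (auto dest: two_sided_sums_unique)
  qed
  have H_intertwines: "H (T x) = shift (\<lambda>n y. y) (H x)" for x
  proof (rule H_eq)
    have sums: "two_sided_sums (\<lambda>n. ?J n (H x (- n))) x" and mem: "\<And>n. H x n \<in> E"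
      using RH[of x] by (auto simp: R_def)
    have "two_sided_sums (\<lambda>n. T (?J n (H x (- n)))) (T x)"
      using two_sided_sums_additive_bounded[of T, OF T_add T_norm sums] .
    from two_sided_sums_translate[OF this]
    have "two_sided_sums (\<lambda>n. ?J n (H x (1 - n))) (T x)"
      by (simp flip: int_iterate_succ[OF bij])
    then show "R (T x) (shift (\<lambda>n y. y) (H x))"
      using mem by (simp add: R_def shift_def)
  qed

  define Y :: "('k, 'a) normed_space" where "Y = \<lparr>points = E, scalar = s, nrm = norm\<rparr>"
  define B where "B = push_forward ?X sc H"
  have Y: "banach_space Y"
    unfolding Y_def using banach_space_closed_subspace[OF nX E] .
  have B: "banach_space B" and HB: "bounded_invertible ?X B H"
    unfolding B_def using banach_space_push_forward[OF assms(1) sc, of H] H_add H_scale H_inj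
    by auto
  have nB: "normed_vector_space B" using B by (simp add: banach_space_def)
  have "bounded_invertible B B (shift (\<lambda>n y. y))"
    using bounded_invertible_intertwined[OF nX nB HB assms(2)] H_intertwines by blast
  moreover have "sequence_banach_space Y B"
    unfolding sequence_banach_space_def
    using B RH by (auto simp: B_def push_forward_def Y_def sc_def R_def)
  moreover have "bounded_invertible Y Y (\<lambda>y. y)"
    using Y by (intro bounded_invertible_identity) (simp add: banach_space_def)
  ultimately have "shift_operator Y (\<lambda>n y. y) B"
    unfolding shift_operator_def using Y by simp
  moreover have "conjugate ?X T B (shift (\<lambda>n y. y))"
    unfolding conjugate_def using HB H_intertwines by blast
  ultimately show ?thesis by blast
qed

end
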